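(* For $0 \leq p \leq 1$, let $d_n(p) = \mathrm{E}_{n,p}[\dim]$ be the expected inductive dimension of a random graph in the Erdős–Rényi probability space $G(n,p)$. Then $$ d_{n+1}(p) = 1+\sum_{k=0}^n \binom{n}{k} p^k (1-p)^{n-k} d_k(p) , $$ where $d_0=-1$. Each $d_n$ is a polynomial in $p$ of degree $\binom{n}{2}$.
   Context: All graphs are finite and undirected. For a graph $G=(V,E)$ and a vertex $v \in V$, the unit sphere $S(v)$ is the subgraph of $G$ whose vertices are the $w \in V$ with $(w,v) \in E$ and whose edges are all $(a,b) \in E$ with $(v,a) \in E$ and $(v,b)\in E$. The inductive dimension of a finite graph is the rational number defined recursively by $\dim(\emptyset) = -1$ for the empty graph (no vertices), and $$\dim(G) = 1 + \frac{1}{|V|}\sum_{v \in V} \dim(S(v))$$ for $V \neq \emptyset$. The probability space $G(n,p)$ is the set of all graphs on a fixed vertex set of $n$ elements, where each of the $n(n-1)/2$ possible edges is present independently with probability $p$. $\mathrm{E}_{n,p}$ denotes expectation on $G(n,p)$. *)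

theory Defs
  imports "HOL-Probability.Probability" "HOL-Computational_Algebra.Polynomial"
begin

type_synonym 'a graph = "'a set \<times> 'a set set"

abbreviation verts :: "'a graph \<Rightarrow> 'a set" where "verts \<equiv> fst"
abbreviation edges :: "'a graph \<Rightarrow> 'a set set" where "edges \<equiv> snd"

definition all_edges :: "'a set \<Rightarrow> 'a set set" where
  "all_edges V = {e. e \<subseteq> V \<and> card e = 2}"

definition simple_graph :: "'a graph \<Rightarrow> bool" where
  "simple_graph G \<longleftrightarrow> finite (verts G) \<and> edges G \<subseteq> all_edges (verts G)"

definition unit_sphere :: "'a graph \<Rightarrow> 'a \<Rightarrow> 'a graph" where
  "unit_sphere G v =
     ({w \<in> verts G. {w, v} \<in> edges G},
      {{a, b} | a b. {a, b} \<in> edges G \<and> {v, a} \<in> edges G \<and> {v, b} \<in> edges G})"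

lemma unit_sphere_less:
  assumes "simple_graph G" "v \<in> verts G"
  shows "card (verts (unit_sphere G v)) < card (verts G)"
proof -
  have "v \<notin> verts (unit_sphere G v)"
    using assms by (auto simp: unit_sphere_def simple_graph_def all_edges_def)
  moreover have "verts (unit_sphere G v) \<subseteq> verts G"
    by (auto simp: unit_sphere_def)
  ultimately show ?thesis
    using assms by (intro psubset_card_mono) (auto simp: simple_graph_def)
qed

lemma simple_graph_unit_sphere:
  assumes "simple_graph G"
  shows "simple_graph (unit_sphere G v)"
proof -
  have "{a, b} \<in> all_edges (verts (unit_sphere G v))"
    if "{a, b} \<in> edges G" "{v, a} \<in> edges G" "{v, b} \<in> edges G" for a b
    using that assms
    by (auto simp: simple_graph_def all_edges_def unit_sphere_def insert_commute)
  then show ?thesis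
    using assms by (auto simp: simple_graph_def unit_sphere_def)
qed

text \<open>The guard \<open>simple_graph G\<close> only secures termination: it is preserved by passing to unit
  spheres, and on simple graphs the function satisfies the unguarded recursion below. The value on
  all other pairs is a dummy.\<close>

function inductive_dim :: "'a graph \<Rightarrow> rat" where
  "inductive_dim G =
     (if simple_graph G \<and> verts G \<noteq> {}
      then 1 + 1 / of_nat (card (verts G)) * (\<Sum>v\<in>verts G. inductive_dim (unit_sphere G v))
      else - 1)"
  by auto
termination
  by (relation "Wellfounded.measure (\<lambda>G. card (verts G))") (auto intro: unit_sphere_less)

declare inductive_dim.simps [simp del]

lemma inductive_dim_empty: "verts G = {} \<Longrightarrow> inductive_dim G = - 1"
  by (simp add: inductive_dim.simps)

lemma inductive_dim_rec:
  assumes "simple_graph G" "verts G \<noteq> {}"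
  shows "inductive_dim G =
    1 + 1 / of_nat (card (verts G)) * (\<Sum>v\<in>verts G. inductive_dim (unit_sphere G v))"
  using assms by (subst inductive_dim.simps) simp

definition random_graph :: "nat \<Rightarrow> real \<Rightarrow> nat graph pmf" where
  "random_graph n p =
     map_pmf (\<lambda>present. ({..<n}, {e \<in> all_edges {..<n}. present e}))
       (Pi_pmf (all_edges {..<n}) False (\<lambda>_. bernoulli_pmf p))"

lemma simple_graph_random_graph: "G \<in> set_pmf (random_graph n p) \<Longrightarrow> simple_graph G"
  by (auto simp: random_graph_def simple_graph_def)

definition expected_dim :: "nat \<Rightarrow> real \<Rightarrow> real" where
  "expected_dim n p =
     measure_pmf.expectation (random_graph n p) (\<lambda>G. of_rat (inductive_dim G))"

end

theory Submission imports Defs begin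

text \<open>
  Let \<open>n = card V - 1\<close>.  By linearity the expected dimension of a random graph on \<open>V\<close> is one plus
  the average, over the vertices \<open>v\<close>, of the expected dimension of \<open>S(v)\<close>.  The edges of the complete
  graph on \<open>V\<close> split into the star at \<open>v\<close> and the edges on \<open>V - {v}\<close>.  The star
  alone decides the vertex set \<open>W\<close> of \<open>S(v)\<close>, a random subset of \<open>V - {v}\<close> that contains each vertex
  independently with probability \<open>p\<close>; by independence of the two parts, once \<open>W\<close> is given, \<open>S(v)\<close> is
  a random graph on \<open>W\<close>.  So its expected dimension is the mean over \<open>W\<close> of the expected dimension
  of a random graph on \<open>W\<close> (\<open>mean_dim_unit_sphere\<close>).

  The expected dimension should depend on the vertex set only through its cardinality.  Instead of
  transporting graphs along bijections, one can define polynomials by the claimed recursion and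
  prove by induction on \<open>card V\<close>, simultaneously for all \<open>V\<close>, that they compute the expected
  dimension (\<open>mean_dim_eq_poly\<close>): the induction hypothesis makes the mean over \<open>W\<close> a function of
  \<open>card W\<close>, and there are \<open>n choose k\<close> sets \<open>W\<close> of size \<open>k\<close>.  Every vertex \<open>v\<close> thus contributes the
  same amount and the average over \<open>v\<close> disappears.

  For the degree, the summand for \<open>k\<close> in the recursion has degree at most \<open>n + (k choose 2)\<close>.
  When \<open>n \<ge> 2\<close> the summand for \<open>k = n\<close>, which is the previous polynomial times the \<open>n\<close>th power of the
  variable, strictly dominates, and \<open>n + (n choose 2) = (n + 1) choose 2\<close>.
\<close>

section \<open>The mean over a random subset of a finite set\<close>

text \<open>The expectation of \<open>f X\<close>, where \<open>X\<close> contains each element of \<open>A\<close> independently with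
  probability \<open>p\<close>.  Written as a finite sum it is a polynomial in \<open>p\<close>, and the identities between
  such means hold for every real \<open>p\<close>; \<open>0 \<le> p \<le> 1\<close> enters only through
  \<open>expectation_Pi_bernoulli\<close>.\<close>

definition subset_mean :: "real \<Rightarrow> 'a set \<Rightarrow> ('a set \<Rightarrow> real) \<Rightarrow> real" where
  "subset_mean p A f = (\<Sum>X\<in>Pow A. p ^ card X * (1 - p) ^ card (A - X) * f X)"

lemma subset_mean_cong:
  "(\<And>X. X \<subseteq> A \<Longrightarrow> f X = g X) \<Longrightarrow> subset_mean p A f = subset_mean p A g"
  unfolding subset_mean_def by (intro sum.cong) auto

lemma subset_mean_empty [simp]: "subset_mean p {} f = f {}"
  by (simp add: subset_mean_def)

text \<open>Conditioning on whether \<open>a\<close> is drawn.\<close>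

lemma subset_mean_insert:
  assumes "finite A" "a \<notin> A"
  shows "subset_mean p (insert a A) f =
    p * subset_mean p A (\<lambda>X. f (insert a X)) + (1 - p) * subset_mean p A f"
proof -
  let ?w = "\<lambda>X. p ^ card X * (1 - p) ^ card (insert a A - X) * f X"
  have "inj_on (insert a) (Pow A)"
    using assms(2) by (auto simp: inj_on_def)
  moreover have "?w (insert a X) = p * (p ^ card X * (1 - p) ^ card (A - X) * f (insert a X))"
    if "X \<in> Pow A" for X
  proof -
    have "finite X" "a \<notin> X" "insert a A - insert a X = A - X"
      using that assms finite_subset by auto
    then show ?thesis by simp
  qed
  ultimately have "(\<Sum>X\<in>insert a ` Pow A. ?w X) = p * subset_mean p A (\<lambda>X. f (insert a X))"
    unfolding subset_mean_def sum_distrib_left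
    by (subst sum.reindex) (auto simp only: o_def intro!: sum.cong)
  moreover have "?w X = (1 - p) * (p ^ card X * (1 - p) ^ card (A - X) * f X)"
    if "X \<in> Pow A" for X
  proof -
    have "insert a A - X = insert a (A - X)" "a \<notin> A - X" "finite (A - X)"
      using that assms by auto
    then show ?thesis by simp
  qed
  then have "(\<Sum>X\<in>Pow A. ?w X) = (1 - p) * subset_mean p A f"
    unfolding subset_mean_def sum_distrib_left by (intro sum.cong) auto
  moreover have "subset_mean p (insert a A) f = (\<Sum>X\<in>Pow A. ?w X) + (\<Sum>X\<in>insert a ` Pow A. ?w X)"
    unfolding subset_mean_def Pow_insert
    using assms by (intro sum.union_disjoint) auto
  ultimately show ?thesis by simp
qed

lemma subset_mean_const [simp]:
  assumes "finite A"
  shows "subset_mean p A (\<lambda>_. c) = c"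
  using assms by (induction A rule: finite_induct) (simp_all add: subset_mean_insert algebra_simps)

lemma subset_mean_add:
  "subset_mean p A (\<lambda>X. f X + g X) = subset_mean p A f + subset_mean p A g"
  by (simp add: subset_mean_def distrib_left sum.distrib)

lemma subset_mean_scale: "subset_mean p A (\<lambda>X. c * f X) = c * subset_mean p A f"
  by (simp add: subset_mean_def sum_distrib_left mult_ac)

lemma subset_mean_sum:
  "subset_mean p A (\<lambda>X. \<Sum>i\<in>I. f i X) = (\<Sum>i\<in>I. subset_mean p A (f i))"
  unfolding subset_mean_def by (simp add: sum_distrib_left sum.swap[of _ I])

text \<open>A Fubini rule: the parts of a random set in disjoint blocks are independent.\<close>

lemma subset_mean_union:
  assumes "finite A" "finite B" "A \<inter> B = {}"
  shows "subset_mean p (A \<union> B) f = subset_mean p A (\<lambda>X. subset_mean p B (\<lambda>Y. f (X \<union> Y)))"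
  using assms
proof (induction A arbitrary: f rule: finite_induct)
  case (insert a A)
  then have "a \<notin> A \<union> B" "finite (A \<union> B)" "A \<inter> B = {}" by auto
  then show ?case
    using insert by (simp add: subset_mean_insert)
qed simp

text \<open>Split \<open>A\<close> into \<open>B\<close> and \<open>A - B\<close>: the choices made in \<open>A - B\<close> average out.\<close>

lemma subset_mean_Int:
  assumes "finite A" "B \<subseteq> A"
  shows "subset_mean p A (\<lambda>X. f (X \<inter> B)) = subset_mean p B f"
proof -
  have fin: "finite B" "finite (A - B)" "B \<inter> (A - B) = {}"
    using assms finite_subset by auto
  have "subset_mean p A (\<lambda>X. f (X \<inter> B)) = subset_mean p (B \<union> (A - B)) (\<lambda>X. f (X \<inter> B))"
    using assms(2) by (simp add: Un_absorb1)
  also have "\<dots> = subset_mean p B (\<lambda>X. subset_mean p (A - B) (\<lambda>Y. f ((X \<union> Y) \<inter> B)))"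
    by (rule subset_mean_union[OF fin])
  also have "\<dots> = subset_mean p B (\<lambda>X. subset_mean p (A - B) (\<lambda>_. f X))"
  proof (intro subset_mean_cong)
    fix X Y assume "X \<subseteq> B" "Y \<subseteq> A - B"
    then have "(X \<union> Y) \<inter> B = X" by auto
    then show "f ((X \<union> Y) \<inter> B) = f X" by simp
  qed
  finally show ?thesis
    using fin by simp
qed

lemma subset_mean_image:
  assumes "finite A" "inj_on g A"
  shows "subset_mean p (g ` A) f = subset_mean p A (\<lambda>X. f (g ` X))"
  using assms
  by (induction A arbitrary: f rule: finite_induct) (simp_all add: subset_mean_insert)

lemma subset_mean_card:
  assumes "finite A"
  shows "subset_mean p A (\<lambda>X. c (card X)) =
    (\<Sum>k=0..card A. real (card A choose k) * p ^ k * (1 - p) ^ (card A - k) * c k)"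
proof -
  have fin: "finite X" if "X \<subseteq> A" for X
    using that assms by (rule finite_subset)
  let ?w = "\<lambda>k. p ^ k * (1 - p) ^ (card A - k) * c k"
  have "subset_mean p A (\<lambda>X. c (card X)) = (\<Sum>X\<in>Pow A. ?w (card X))"
    unfolding subset_mean_def by (intro sum.cong) (auto simp: card_Diff_subset fin)
  also have "\<dots> = (\<Sum>k=0..card A. \<Sum>X | X \<in> Pow A \<and> card X = k. ?w (card X))"
    using assms by (intro sum.group[symmetric]) (auto simp: card_mono)
  also have "\<dots> = (\<Sum>k=0..card A. real (card A choose k) * ?w k)"
    by (simp add: n_subsets[OF assms])
  finally show ?thesis
    by (simp add: mult.assoc)
qed

lemma expectation_Pi_bernoulli:
  assumes "finite A" "0 \<le> p" "p \<le> 1"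
  shows "measure_pmf.expectation (Pi_pmf A False (\<lambda>_. bernoulli_pmf p)) (\<lambda>h. f {x \<in> A. h x}) =
    subset_mean p A f"
proof -
  let ?M = "Pi_pmf A False (\<lambda>_. bernoulli_pmf p)"
  have pmf: "pmf ?M (\<lambda>x. x \<in> X) = p ^ card X * (1 - p) ^ card (A - X)" if "X \<subseteq> A" for X
  proof -
    have "pmf ?M (\<lambda>x. x \<in> X) = (\<Prod>x\<in>A. if x \<in> X then p else 1 - p)"
      using that assms by (subst pmf_Pi') (auto intro!: prod.cong)
    also have "\<dots> = p ^ card X * (1 - p) ^ card (A - X)"
      using that assms(1) by (simp add: prod.If_cases Int_absorb1 Diff_eq)
    finally show ?thesis .
  qed
  \<comment> \<open>Outside \<open>A\<close> the product distribution yields the default value \<open>False\<close>, so its outcomes are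
    exactly the membership predicates of subsets of \<open>A\<close>.\<close>
  have supp: "set_pmf ?M \<subseteq> (\<lambda>X x. x \<in> X) ` Pow A"
  proof
    fix h assume h: "h \<in> set_pmf ?M"
    have "x \<in> A" if "h x" for x
      using subsetD[OF set_Pi_pmf_subset[OF assms(1)] h] that by auto
    then have "{x. h x} \<in> Pow A" by auto
    then show "h \<in> (\<lambda>X x. x \<in> X) ` Pow A"
      by (rule image_eqI[rotated]) simp
  qed
  have inj: "inj_on (\<lambda>X x. x \<in> X) (Pow A)"
    by (auto simp: inj_on_def fun_eq_iff)
  have "measure_pmf.expectation ?M (\<lambda>h. f {x \<in> A. h x}) =
      (\<Sum>h\<in>(\<lambda>X x. x \<in> X) ` Pow A. pmf ?M h * f {x \<in> A. h x})"
    using supp assms(1)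
    by (subst integral_measure_pmf[of "(\<lambda>X x. x \<in> X) ` Pow A"]) (simp_all add: subsetD)
  also have "\<dots> = (\<Sum>X\<in>Pow A. pmf ?M (\<lambda>x. x \<in> X) * f {x \<in> A. x \<in> X})"
    by (subst sum.reindex[OF inj]) simp
  also have "\<dots> = subset_mean p A f"
    unfolding subset_mean_def
  proof (rule sum.cong)
    fix X assume "X \<in> Pow A"
    moreover from this have "{x \<in> A. x \<in> X} = X" by auto
    ultimately show "pmf ?M (\<lambda>x. x \<in> X) * f {x \<in> A. x \<in> X} =
        p ^ card X * (1 - p) ^ card (A - X) * f X"
      by (simp only: pmf Pow_iff)
  qed simp
  finally show ?thesis .
qed

section \<open>The unit spheres of a random graph\<close>

lemma finite_all_edges: "finite V \<Longrightarrow> finite (all_edges V)"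
  by (rule finite_subset[of _ "Pow V"]) (auto simp: all_edges_def)

lemma doubleton_in_all_edges [simp]: "{a, b} \<in> all_edges V \<longleftrightarrow> a \<in> V \<and> b \<in> V \<and> a \<noteq> b"
  by (auto simp: all_edges_def card_2_iff doubleton_eq_iff)

lemma all_edges_obtain:
  assumes "e \<in> all_edges V"
  obtains a b where "e = {a, b}" "a \<in> V" "b \<in> V" "a \<noteq> b"
  using assms by (auto simp: all_edges_def card_2_iff)

definition mean_dim :: "real \<Rightarrow> 'a set \<Rightarrow> real" where
  "mean_dim p V = subset_mean p (all_edges V) (\<lambda>E. of_rat (inductive_dim (V, E)))"

lemma expected_dim_eq_mean_dim:
  assumes "0 \<le> p" "p \<le> 1"
  shows "expected_dim n p = mean_dim p {..<n}"
  unfolding expected_dim_def random_graph_def mean_dim_def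
  using assms finite_all_edges[of "{..<n}"]
    expectation_Pi_bernoulli[of "all_edges {..<n}" p "\<lambda>E. of_rat (inductive_dim ({..<n}, E))"]
  by simp

lemma all_edges_insert:
  assumes "v \<notin> U"
  shows "all_edges (insert v U) = (\<lambda>w. {v, w}) ` U \<union> all_edges U"
proof (intro equalityI subsetI)
  fix e assume "e \<in> all_edges (insert v U)"
  then show "e \<in> (\<lambda>w. {v, w}) ` U \<union> all_edges U"
    by (elim all_edges_obtain) (auto simp: insert_commute)
qed (use assms in \<open>auto simp: all_edges_def card_insert_if\<close>)

lemma unit_sphere_star_union:
  assumes "v \<notin> U" "W \<subseteq> U" "Y \<subseteq> all_edges U"
  shows "unit_sphere (insert v U, (\<lambda>w. {v, w}) ` W \<union> Y) v = (W, Y \<inter> all_edges W)"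
proof -
  let ?E = "(\<lambda>w. {v, w}) ` W \<union> Y"
  have Y_sub: "a \<in> U \<and> b \<in> U \<and> a \<noteq> b" if "{a, b} \<in> Y" for a b
    using subsetD[OF assms(3) that] by simp
  have star: "{v, w} \<in> ?E \<longleftrightarrow> w \<in> W" for w
    using assms(1) Y_sub[of v w] by (auto simp: doubleton_eq_iff)
  have "{w \<in> insert v U. {w, v} \<in> ?E} = W"
    using star assms(2) by (auto simp: insert_commute)
  moreover have "{{a, b} | a b. {a, b} \<in> ?E \<and> {v, a} \<in> ?E \<and> {v, b} \<in> ?E} = Y \<inter> all_edges W"
    (is "?L = _")
  proof (intro equalityI subsetI)
    fix e assume "e \<in> ?L"
    then obtain a b where e: "e = {a, b}" "{a, b} \<in> ?E" "a \<in> W" "b \<in> W"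
      unfolding star by auto
    then have "a \<noteq> v" "b \<noteq> v"
      using assms by auto
    then have "{a, b} \<notin> (\<lambda>w. {v, w}) ` W"
      by (auto simp: doubleton_eq_iff)
    with e(2) have "{a, b} \<in> Y" by simp
    with e Y_sub show "e \<in> Y \<inter> all_edges W" by simp
  next
    fix e assume e: "e \<in> Y \<inter> all_edges W"
    then obtain a b where "e = {a, b}" "a \<in> W" "b \<in> W"
      using all_edges_obtain by blast
    with e show "e \<in> ?L"
      unfolding star by auto
  qed
  ultimately show ?thesis
    by (simp add: unit_sphere_def)
qed

text \<open>The outer mean draws the star at \<open>v\<close>, hence the vertex set \<open>W\<close> of the sphere; the edges that
  do not lie inside \<open>W\<close> then average out.\<close>

lemma mean_dim_unit_sphere:
  assumes "finite U" "v \<notin> U"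
  shows "subset_mean p (all_edges (insert v U))
      (\<lambda>E. of_rat (inductive_dim (unit_sphere (insert v U, E) v))) =
    subset_mean p U (mean_dim p)"
proof -
  let ?f = "\<lambda>E. of_rat (inductive_dim (unit_sphere (insert v U, E) v)) :: real"
  let ?star = "\<lambda>W. (\<lambda>w. {v, w}) ` W"
  have inj: "inj_on (\<lambda>w. {v, w}) U"
    by (auto simp: inj_on_def doubleton_eq_iff)
  have disj: "?star U \<inter> all_edges U = {}"
    using assms(2) by auto
  have fin: "finite (all_edges U)"
    using assms(1) by (rule finite_all_edges)
  have "subset_mean p (all_edges (insert v U)) ?f =
      subset_mean p (?star U) (\<lambda>X. subset_mean p (all_edges U) (\<lambda>Y. ?f (X \<union> Y)))"
    using subset_mean_union[OF _ fin disj] assms by (simp add: all_edges_insert)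
  also have "\<dots> = subset_mean p U (\<lambda>W. subset_mean p (all_edges U) (\<lambda>Y. ?f (?star W \<union> Y)))"
    using assms(1) inj by (rule subset_mean_image)
  also have "\<dots> = subset_mean p U (mean_dim p)"
  proof (rule subset_mean_cong)
    fix W assume W: "W \<subseteq> U"
    then have sub: "all_edges W \<subseteq> all_edges U"
      by (auto simp: all_edges_def)
    have "subset_mean p (all_edges U) (\<lambda>Y. ?f (?star W \<union> Y)) =
        subset_mean p (all_edges U) (\<lambda>Y. of_rat (inductive_dim (W, Y \<inter> all_edges W)))"
      using assms(2) W by (intro subset_mean_cong) (simp add: unit_sphere_star_union)
    also have "\<dots> = mean_dim p W"
      unfolding mean_dim_def
      using subset_mean_Int[OF fin sub, of p "\<lambda>Y. of_rat (inductive_dim (W, Y))"] .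
    finally show "subset_mean p (all_edges U) (\<lambda>Y. ?f (?star W \<union> Y)) = mean_dim p W" .
  qed
  finally show ?thesis .
qed

lemma mean_dim_rec:
  assumes "finite V" "V \<noteq> {}"
  shows "mean_dim p V = 1 + 1 / card V * (\<Sum>v\<in>V. subset_mean p (V - {v}) (mean_dim p))"
proof -
  have "mean_dim p V = subset_mean p (all_edges V)
      (\<lambda>E. 1 + 1 / card V * (\<Sum>v\<in>V. of_rat (inductive_dim (unit_sphere (V, E) v))))"
    unfolding mean_dim_def
    by (intro subset_mean_cong, subst inductive_dim_rec)
      (use assms in \<open>auto simp: simple_graph_def of_rat_add of_rat_mult of_rat_divide of_rat_sum\<close>)
  also have "\<dots> = 1 + 1 / card V *
      (\<Sum>v\<in>V. subset_mean p (all_edges V) (\<lambda>E. of_rat (inductive_dim (unit_sphere (V, E) v))))"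
    using assms(1)
    by (simp only: subset_mean_add subset_mean_scale subset_mean_sum subset_mean_const
        finite_all_edges)
  also have "\<dots> = 1 + 1 / card V * (\<Sum>v\<in>V. subset_mean p (V - {v}) (mean_dim p))"
  proof -
    have "subset_mean p (all_edges V) (\<lambda>E. of_rat (inductive_dim (unit_sphere (V, E) v))) =
        subset_mean p (V - {v}) (mean_dim p)" if "v \<in> V" for v
      using mean_dim_unit_sphere[of "V - {v}" v p] that assms(1) by (simp add: insert_absorb)
    then show ?thesis by simp
  qed
  finally show ?thesis .
qed

section \<open>The dimension polynomials\<close>

definition binomial_poly :: "nat \<Rightarrow> nat \<Rightarrow> real poly" where
  "binomial_poly n k = of_nat (n choose k) * [:0, 1:] ^ k * [:1, - 1:] ^ (n - k)"

lemma poly_binomial_poly: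
  "poly (binomial_poly n k) p = real (n choose k) * p ^ k * (1 - p) ^ (n - k)"
  by (simp add: binomial_poly_def)

lemma degree_binomial_poly_le:
  assumes "k \<le> n"
  shows "degree (binomial_poly n k) \<le> n"
proof -
  have "degree ([:0, 1:] ^ k :: real poly) \<le> k" "degree ([:1, - 1:] ^ (n - k) :: real poly) \<le> n - k"
    using degree_power_le[of "[:0, 1:] :: real poly" k]
      degree_power_le[of "[:1, - 1:] :: real poly" "n - k"] by simp_all
  moreover have "degree (binomial_poly n k) \<le>
      0 + degree ([:0, 1:] ^ k :: real poly) + degree ([:1, - 1:] ^ (n - k) :: real poly)"
    unfolding binomial_poly_def
    by (intro order.trans[OF degree_mult_le] add_mono) simp_all
  ultimately show ?thesis
    using assms by linarith
qed

lemma binomial_poly_self: "binomial_poly n n = monom 1 n"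
  by (simp add: binomial_poly_def monom_altdef)

fun dim_poly :: "nat \<Rightarrow> real poly" where
  "dim_poly 0 = - 1"
| "dim_poly (Suc n) = 1 + (\<Sum>k=0..n. binomial_poly n k * dim_poly k)"

lemmas dim_poly_Suc = dim_poly.simps(2)
declare dim_poly_Suc [simp del]

lemma mean_dim_eq_poly:
  assumes "finite V"
  shows "mean_dim p V = poly (dim_poly (card V)) p"
  using assms
proof (induction "card V" arbitrary: V rule: less_induct)
  case less
  show ?case
  proof (cases "V = {}")
    case True
    then have "all_edges V = {}"
      by (auto simp: all_edges_def)
    with True show ?thesis
      by (simp add: mean_dim_def inductive_dim_empty)
  next
    case False
    with less.prems obtain n where n: "card V = Suc n"
      by (metis card_eq_0_iff not0_implies_Suc)
    let ?s = "\<Sum>k=0..n. real (n choose k) * p ^ k * (1 - p) ^ (n - k) * poly (dim_poly k) p"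
    have "subset_mean p (V - {v}) (mean_dim p) = ?s" if v: "v \<in> V" for v
    proof -
      have "subset_mean p (V - {v}) (mean_dim p) =
          subset_mean p (V - {v}) (\<lambda>W. poly (dim_poly (card W)) p)"
      proof (rule subset_mean_cong)
        fix W assume "W \<subseteq> V - {v}"
        then have "W \<subset> V" using v by auto
        then show "mean_dim p W = poly (dim_poly (card W)) p"
          using less.hyps less.prems psubset_card_mono finite_subset by blast
      qed
      moreover have "card (V - {v}) = n"
        using n v less.prems by simp
      ultimately show ?thesis
        using subset_mean_card[of "V - {v}" p "\<lambda>k. poly (dim_poly k) p"] less.prems by simp
    qed
    then have "mean_dim p V = 1 + ?s"
      using mean_dim_rec[OF less.prems False, of p] n by (simp del: of_nat_Suc)
    then show ?thesis
      by (simp add: n dim_poly_Suc poly_sum poly_binomial_poly)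
  qed
qed

lemma choose_two_strict_mono:
  assumes "k < n" "2 \<le> n"
  shows "k choose 2 < n choose 2"
proof (cases "k = 0")
  case False
  have "k choose 2 < Suc k choose 2"
    using False by (simp add: numeral_2_eq_2)
  also have "\<dots> \<le> n choose 2"
    using assms by (intro binomial_right_mono) simp
  finally show ?thesis .
qed (use assms in \<open>simp add: binomial_eq_0\<close>)

text \<open>For \<open>n < 2\<close> the last summand need not dominate: at \<open>n = 0\<close> it cancels the constant \<open>1\<close>, and at
  \<open>n = 1\<close> it vanishes.  So the three smallest polynomials are computed; they are \<open>-1\<close>, \<open>0\<close> and the
  variable itself.\<close>

lemma degree_dim_poly: "degree (dim_poly n) = n choose 2"
proof (induction n rule: less_induct)
  case (less m)
  have d1: "dim_poly 1 = 0"
    by (simp add: dim_poly_Suc binomial_poly_def)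
  have d2: "dim_poly 2 = [:0, 1:]"
    using d1 by (simp add: numeral_2_eq_2 dim_poly_Suc binomial_poly_def one_pCons)
  consider "m = 0" | "m = 1" | "m = 2" | n where "m = Suc n" "2 \<le> n"
    by (metis One_nat_def Suc_1 not0_implies_Suc not_less_eq_eq le_antisym le_zero_eq)
  then show ?case
  proof cases
    case (4 n)
    have pos: "0 < n choose 2"
      using 4 by simp
    have IH: "degree (dim_poly k) = k choose 2" if "k \<le> n" for k
      using less 4 that by simp
    have top: "degree (binomial_poly n n * dim_poly n) = n + (n choose 2)"
    proof -
      have "dim_poly n \<noteq> 0"
        using IH[of n] pos by auto
      then show ?thesis
        using IH[of n] by (simp add: binomial_poly_self degree_mult_eq degree_monom_eq)
    qed
    have "degree (binomial_poly n k * dim_poly k) < n + (n choose 2)" if "k < n" for k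
    proof -
      have "degree (binomial_poly n k * dim_poly k) \<le> n + (k choose 2)"
        using that degree_mult_le[of "binomial_poly n k" "dim_poly k"]
          degree_binomial_poly_le[of k n] IH[of k] by simp
      then show ?thesis
        using choose_two_strict_mono[OF that] 4 by simp
    qed
    then have "degree (\<Sum>k<n. binomial_poly n k * dim_poly k) < n + (n choose 2)"
      using pos by (intro degree_sum_less) auto
    then have "degree (1 + (\<Sum>k<n. binomial_poly n k * dim_poly k)) < n + (n choose 2)"
      using pos by (intro degree_add_less) auto
    moreover have "dim_poly (Suc n) =
        (1 + (\<Sum>k<n. binomial_poly n k * dim_poly k)) + binomial_poly n n * dim_poly n"
      by (simp add: dim_poly_Suc atLeast0AtMost lessThan_Suc_atMost[symmetric])
    ultimately have "degree (dim_poly (Suc n)) = n + (n choose 2)"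
      using top by (simp only: degree_add_eq_right)
    then show ?thesis
      using 4 by (simp add: numeral_2_eq_2)
  qed (use d1 d2 in \<open>auto simp: binomial_eq_0\<close>)
qed

section \<open>The expected dimension\<close>

lemma expected_dim_eq_poly:
  assumes "0 \<le> p" "p \<le> 1"
  shows "expected_dim n p = poly (dim_poly n) p"
  using assms by (simp add: expected_dim_eq_mean_dim mean_dim_eq_poly)

theorem theorem4p1:
  "(\<forall>n. \<forall>p::real. 0 \<le> p \<and> p \<le> 1 \<longrightarrow>
      expected_dim (n + 1) p =
        1 + (\<Sum>k=0..n. real (n choose k) * p ^ k * (1 - p) ^ (n - k) * expected_dim k p)) \<and>
   (\<forall>p::real. 0 \<le> p \<and> p \<le> 1 \<longrightarrow> expected_dim 0 p = - 1) \<and>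
   (\<forall>n. \<exists>P::real poly. degree P = n choose 2 \<and>
      (\<forall>p::real. 0 \<le> p \<and> p \<le> 1 \<longrightarrow> expected_dim n p = poly P p))"
proof (intro conjI allI impI)
  fix n and p :: real assume p: "0 \<le> p \<and> p \<le> 1"
  then show "expected_dim (n + 1) p =
      1 + (\<Sum>k=0..n. real (n choose k) * p ^ k * (1 - p) ^ (n - k) * expected_dim k p)"
    by (simp add: expected_dim_eq_poly dim_poly_Suc poly_sum poly_binomial_poly)
next
  fix p :: real assume "0 \<le> p \<and> p \<le> 1"
  then show "expected_dim 0 p = - 1"
    by (simp add: expected_dim_eq_poly)
next
  fix n
  show "\<exists>P::real poly. degree P = n choose 2 \<and>
      (\<forall>p::real. 0 \<le> p \<and> p \<le> 1 \<longrightarrow> expected_dim n p = poly P p)"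
    using degree_dim_poly expected_dim_eq_poly by blast
qed

end
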